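(* Let $u=(u_n)_{n\ge0}$ be a binary sequence that is eventually periodic, i.e. there exist integers $n_0\ge0$ and $q\ge1$ such that $u_{n+q}=u_n$ for all $n\ge n_0$. Then $L_u(N)\gg_u N^{1/2}$; that is, there is a constant $c_u>0$ depending only on $u$ such that $L_u(N)\ge c_u N^{1/2}$ for all integers $N\ge1$.
   Context: For a binary sequence $u=(u_n)_{n\ge0}$ (each $u_n\in\{0,1\}$), define $X_0=1$ and $X_{n+1}=2X_n+u_n$ for $n\ge0$. Let $A_u$ be the set of all sums $\sum_{n\in S}X_n$ over nonempty finite sets $S\subset\mathbb Z_{\ge0}$. For an integer $N\ge1$, $L_u(N)$ is the maximum of $|P|$ over all arithmetic progressions $P\subseteq A_u\cap[1,N]$, where an arithmetic progression is a set $\{a,a+d,\ldots,a+(\ell-1)d\}$ with integer common difference $d\ge1$ and length $\ell\ge 1$. *)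

theory Defs
  imports Complex_Main
begin

definition binary_seq :: "(nat \<Rightarrow> nat) \<Rightarrow> bool" where
  "binary_seq u \<longleftrightarrow> (\<forall>n. u n \<in> {0, 1})"

definition eventually_periodic :: "(nat \<Rightarrow> 'a) \<Rightarrow> bool" where
  "eventually_periodic u \<longleftrightarrow> (\<exists>n0 q. q \<ge> 1 \<and> (\<forall>n\<ge>n0. u (n + q) = u n))"

primrec Xseq :: "(nat \<Rightarrow> nat) \<Rightarrow> nat \<Rightarrow> nat" where
  "Xseq u 0 = 1"
| "Xseq u (Suc n) = 2 * Xseq u n + u n"

definition Aset :: "(nat \<Rightarrow> nat) \<Rightarrow> nat set" where
  "Aset u = {\<Sum>n\<in>S. Xseq u n | S. finite S \<and> S \<noteq> {}}"

(* A natural first term a loses nothing: the progressions considered lie in {1..N}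
   and are nonempty, so they contain their first term. *)
definition arith_prog :: "nat set \<Rightarrow> bool" where
  "arith_prog P \<longleftrightarrow> (\<exists>a d l. d \<ge> 1 \<and> l \<ge> 1 \<and> P = {a + i * d | i. i < l})"

definition Lmax :: "(nat \<Rightarrow> nat) \<Rightarrow> nat \<Rightarrow> nat" where
  "Lmax u N = Max {card P | P. arith_prog P \<and> P \<subseteq> Aset u \<inter> {1..N}}"

(* For N \<ge> 1 the maximum is over a finite nonempty set, so Max is a genuine maximum. *)
lemma finite_Lmax_set: "finite {card P | P. arith_prog P \<and> P \<subseteq> Aset u \<inter> {1..N}}"
proof -
  have "{card P | P. arith_prog P \<and> P \<subseteq> Aset u \<inter> {1..N}} \<subseteq> card ` Pow {1..N}"
    by auto
  then show ?thesis
    by (rule finite_subset) simp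
qed

lemma nonempty_Lmax_set:
  assumes "N \<ge> 1"
  shows "{card P | P. arith_prog P \<and> P \<subseteq> Aset u \<inter> {1..N}} \<noteq> {}"
proof -
  have "1 \<in> Aset u"
    unfolding Aset_def by (rule CollectI, rule exI[of _ "{0}"]) simp
  moreover have "arith_prog {1}"
    unfolding arith_prog_def by (rule exI[of _ 1], rule exI[of _ 1], rule exI[of _ 1]) auto
  ultimately show ?thesis
    using assms by auto
qed

end

theory Submission
  imports Defs
begin

text \<open>
  Along a multiple \<open>m\<close> of the period, the recursion gives
  \<open>X\<^bsub>n+m+1\<^esub> - X\<^bsub>n+1\<^esub> = 2 (X\<^bsub>n+m\<^esub> - X\<^bsub>n\<^esub>)\<close> for \<open>n \<ge> n\<^sub>0\<close>, because the added digits cancel.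
  Hence with \<open>D = X\<^bsub>n\<^sub>0+m\<^esub> - X\<^bsub>n\<^sub>0\<^esub>\<close>, replacing the term of index \<open>n\<^sub>0 + i\<close> in a subset sum by the
  term of index \<open>n\<^sub>0 + m + i\<close> raises the sum by exactly \<open>2\<^sup>i D\<close>
  (\<open>Xseq_shift_period\<close>).

  Take the \<open>m\<close> disjoint pairs of indices \<open>{n\<^sub>0 + i, n\<^sub>0 + m + i}\<close>, \<open>i < m\<close>, and pick one index from each
  pair, the larger one precisely when the \<open>i\<close>-th binary digit of \<open>v\<close> is \<open>1\<close>. The resulting sum is
  \<open>a + v D\<close>, where \<open>a\<close> does not depend on \<open>v\<close>; as \<open>v\<close> runs through \<open>0, \<dots>, 2\<^sup>m - 1\<close> this is an
  arithmetic progression of length \<open>2\<^sup>m\<close> in \<open>A\<^sub>u\<close> (\<open>paired_subset_sum\<close>). Only indices below \<open>n\<^sub>0 + 2m\<close>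
  occur, so all its terms are of size \<open>O(2\<^bsup>2m\<^esup>)\<close>, the square of the length. Choosing for \<open>m\<close> the largest
  multiple of the period for which this bound is at most \<open>N\<close> loses only a constant factor.
\<close>

lemma Xseq_pos: "Xseq u n \<ge> 1"
  by (induction n) auto

lemma strict_mono_Xseq: "strict_mono (Xseq u)"
  unfolding strict_mono_Suc_iff
proof
  fix n
  show "Xseq u n < Xseq u (Suc n)"
    using Xseq_pos[of u n] by simp
qed

lemma Xseq_less_power:
  assumes "binary_seq u"
  shows "Xseq u n < 2 ^ Suc n"
proof (induction n)
  case (Suc n)
  have "u n \<le> 1"
    using assms unfolding binary_seq_def by (metis insertE le_numeral_extra(4) singletonD zero_le_one)
  then show ?case
    using Suc by simp
qed simp

lemma sum_Xseq_le: "(\<Sum>j<n. Xseq u j) \<le> Xseq u n"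
  by (induction n) auto

lemma subset_sum_Xseq_less:
  assumes "binary_seq u" and "S \<subseteq> {..<k}"
  shows "(\<Sum>n\<in>S. Xseq u n) < 2 ^ Suc k"
proof -
  have "(\<Sum>n\<in>S. Xseq u n) \<le> (\<Sum>n<k. Xseq u n)"
    using assms(2) by (intro sum_mono2) auto
  also have "\<dots> \<le> Xseq u k"
    by (rule sum_Xseq_le)
  also have "\<dots> < 2 ^ Suc k"
    by (rule Xseq_less_power[OF assms(1)])
  finally show ?thesis .
qed

text \<open>The digits added at \<open>n\<close> and at \<open>n + m\<close> agree, so each step of the recursion just doubles the
  difference of the two terms.\<close>

lemma Xseq_shift_period:
  assumes "\<And>n. n \<ge> n0 \<Longrightarrow> u (n + m) = u n"
  shows "Xseq u (n0 + m + i) = Xseq u (n0 + i) + 2 ^ i * (Xseq u (n0 + m) - Xseq u n0)"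
proof (induction i)
  case 0
  have "Xseq u n0 \<le> Xseq u (n0 + m)"
    using strict_mono_Xseq[of u] by (simp add: strict_mono_less_eq)
  then show ?case
    by simp
next
  case (Suc i)
  have "u (n0 + m + i) = u (n0 + i)"
    using assms[of "n0 + i"] by (simp add: ac_simps)
  then show ?case
    using Suc by (simp add: algebra_simps)
qed

lemma sum_binary_digits:
  fixes v :: nat
  assumes "v < 2 ^ m"
  shows "(\<Sum>i<m. of_bool (bit v i) * 2 ^ i) = v"
proof -
  have "v = take_bit m v"
    using assms by (simp add: take_bit_nat_eq_self)
  also have "\<dots> = (\<Sum>i<m. of_bool (bit v i) * 2 ^ i)"
    by (simp add: take_bit_sum push_bit_eq_mult atLeast0LessThan)
  finally show ?thesis ..
qed

text \<open>The set takes \<open>n0 + m + i\<close> instead of \<open>n0 + i\<close> exactly when \<open>2 ^ i\<close> occurs in the binary expansion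
  of \<open>v\<close>; each such choice raises the sum by \<open>2 ^ i\<close> times the fixed difference. The bound on \<open>S\<close> controls the size of the sum, and its cardinality makes \<open>S\<close> nonempty
  as soon as \<open>m \<ge> 1\<close>.\<close>

lemma paired_subset_sum:
  assumes per: "\<And>n. n \<ge> n0 \<Longrightarrow> u (n + m) = u n"
    and v: "v < 2 ^ m"
  obtains S where "S \<subseteq> {..<n0 + 2 * m}" and "card S = m"
    and "(\<Sum>n\<in>S. Xseq u n) = (\<Sum>i<m. Xseq u (n0 + i)) + v * (Xseq u (n0 + m) - Xseq u n0)"
proof -
  define D where "D = Xseq u (n0 + m) - Xseq u n0"
  define idx where "idx = (\<lambda>i. if bit v i then n0 + m + i else n0 + i)"
  have inj: "inj_on idx {..<m}"
    by (auto simp: inj_on_def idx_def split: if_splits)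
  have "(\<Sum>n\<in>idx ` {..<m}. Xseq u n) = (\<Sum>i<m. Xseq u (idx i))"
    by (simp add: sum.reindex[OF inj])
  also have "\<dots> = (\<Sum>i<m. Xseq u (n0 + i) + of_bool (bit v i) * 2 ^ i * D)"
    using Xseq_shift_period[of n0 u m, OF per]
    by (intro sum.cong) (auto simp: idx_def D_def)
  also have "\<dots> = (\<Sum>i<m. Xseq u (n0 + i)) + (\<Sum>i<m. of_bool (bit v i) * 2 ^ i) * D"
    by (simp only: sum.distrib sum_distrib_right)
  also have "(\<Sum>i<m. of_bool (bit v i) * 2 ^ i) = v"
    by (rule sum_binary_digits[OF v])
  finally have "(\<Sum>n\<in>idx ` {..<m}. Xseq u n) = (\<Sum>i<m. Xseq u (n0 + i)) + v * D" .
  moreover have "idx ` {..<m} \<subseteq> {..<n0 + 2 * m}"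
    by (auto simp: idx_def)
  moreover have "card (idx ` {..<m}) = m"
    by (simp add: card_image[OF inj])
  ultimately show thesis
    using that unfolding D_def by blast
qed

lemma card_arith_prog_le_Lmax:
  assumes "d \<ge> 1" and "l \<ge> 1" and "\<And>i. i < l \<Longrightarrow> a + i * d \<in> Aset u \<inter> {1..N}"
  shows "l \<le> Lmax u N"
proof -
  let ?P = "{a + i * d | i. i < l}"
  have "?P = (\<lambda>i. a + i * d) ` {..<l}"
    by auto
  moreover have "inj_on (\<lambda>i. a + i * d) {..<l}"
    using assms(1) by (auto simp: inj_on_def)
  ultimately have "card ?P = l"
    by (simp add: card_image)
  moreover have "arith_prog ?P"
    using assms(1,2) unfolding arith_prog_def by blast
  moreover have "?P \<subseteq> Aset u \<inter> {1..N}"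
    using assms(3) by auto
  ultimately have "l \<in> {card P | P. arith_prog P \<and> P \<subseteq> Aset u \<inter> {1..N}}"
    by (metis (mono_tags, lifting) mem_Collect_eq)
  then show ?thesis
    unfolding Lmax_def by (rule Max_ge[OF finite_Lmax_set])
qed

lemma Lmax_ge_1:
  assumes "N \<ge> 1"
  shows "Lmax u N \<ge> 1"
proof (rule card_arith_prog_le_Lmax[of 1 1 1])
  have "1 \<in> Aset u"
    unfolding Aset_def by (rule CollectI, rule exI[of _ "{0}"]) simp
  then show "1 + i * 1 \<in> Aset u \<inter> {1..N}" if "i < 1" for i
    using that assms by simp
qed auto

lemma Lmax_ge_power:
  assumes bin: "binary_seq u"
    and per: "\<And>n. n \<ge> n0 \<Longrightarrow> u (n + m) = u n"
    and m: "m \<ge> 1"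
    and N: "2 ^ (n0 + 2 * m + 1) \<le> N"
  shows "2 ^ m \<le> Lmax u N"
proof (rule card_arith_prog_le_Lmax)
  show "Xseq u (n0 + m) - Xseq u n0 \<ge> 1"
    using m strict_mono_Xseq[of u] by (simp add: strict_mono_less Suc_le_eq)
  fix v :: nat
  assume "v < 2 ^ m"
  then obtain S where S: "S \<subseteq> {..<n0 + 2 * m}" "card S = m"
    and sum: "(\<Sum>n\<in>S. Xseq u n)
      = (\<Sum>i<m. Xseq u (n0 + i)) + v * (Xseq u (n0 + m) - Xseq u n0)" (is "_ = ?x")
    using paired_subset_sum[of n0 u m v, OF per] by metis
  have fin: "finite S" and ne: "S \<noteq> {}"
    using S m finite_subset by auto
  have "?x \<in> Aset u"
    unfolding Aset_def using fin ne sum[symmetric] by blast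
  moreover have "?x \<le> N"
    using subset_sum_Xseq_less[OF bin S(1)] sum N by simp
  moreover have "?x \<ge> 1"
  proof -
    obtain j where "j \<in> S"
      using ne by blast
    then have "Xseq u j \<le> (\<Sum>n\<in>S. Xseq u n)"
      using fin by (intro member_le_sum) auto
    then show ?thesis
      using Xseq_pos[of u j] sum by simp
  qed
  ultimately show "?x \<in> Aset u \<inter> {1..N}"
    by simp
qed simp

lemma periodic_multiple:
  fixes n0 q :: nat
  assumes "\<And>n. n \<ge> n0 \<Longrightarrow> u (n + q) = u n" and "n \<ge> n0"
  shows "u (n + q * t) = u n"
proof (induction t)
  case (Suc t)
  then show ?case
    using assms(1)[of "n + q * t"] assms(2) by (simp add: ac_simps)
qed simp

theorem proposition4p1:
  fixes u :: "nat \<Rightarrow> nat"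
  assumes "binary_seq u"
    and "eventually_periodic u"
  shows "\<exists>c::real. c > 0 \<and> (\<forall>N::nat. N \<ge> 1 \<longrightarrow> real (Lmax u N) \<ge> c * sqrt (real N))"
proof -
  obtain n0 q where q: "q \<ge> 1" and per: "\<And>n. n \<ge> n0 \<Longrightarrow> u (n + q) = u n"
    using assms(2) unfolding eventually_periodic_def by blast
  define K where "K = n0 + 2 * q + 1"
  define c :: real where "c = 1 / sqrt (2 ^ K)"
  have "real (Lmax u N) \<ge> c * sqrt (real N)" if "N \<ge> 1" for N
  proof -
    define bound :: "nat \<Rightarrow> nat" where "bound t = 2 ^ (n0 + 2 * (q * t) + 1)" for t
    \<comment> \<open>\<open>bound t\<close> bounds the progression built from \<open>m = q * t\<close>. For \<open>t \<ge> 1\<close> minimality puts that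
      progression below \<open>N\<close>; for \<open>t = 0\<close> a single point already has the length \<open>2 ^ (q * 0) = 1\<close>.\<close>
    define t where "t = (LEAST t. N < bound (Suc t))"
    have "N < bound (Suc N)"
    proof -
      have "N < 2 ^ N"
        by (rule less_exp)
      also have "\<dots> \<le> bound (Suc N)"
      proof -
        have "N \<le> q * N"
          using q by simp
        then have "N \<le> n0 + 2 * (q * Suc N) + 1"
          unfolding mult_Suc_right by (rule order_trans) simp
        then show ?thesis
          unfolding bound_def by (intro power_increasing) auto
      qed
      finally show ?thesis .
    qed
    then have upper: "N < bound (Suc t)"
      unfolding t_def by (rule LeastI)
    have lower: "2 ^ (q * t) \<le> Lmax u N"
    proof (cases t)
      case 0
      then show ?thesis
        using Lmax_ge_1[OF that] by simp
    next
      case (Suc s)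
      then have "\<not> N < bound (Suc s)"
        unfolding t_def by (intro not_less_Least) simp
      then have "2 ^ (n0 + 2 * (q * t) + 1) \<le> N"
        unfolding Suc bound_def by simp
      moreover have "q * t \<ge> 1"
        using q Suc by simp
      ultimately show ?thesis
        using Lmax_ge_power[OF assms(1), of n0 "q * t"] periodic_multiple[of n0 u q, OF per] by blast
    qed
    have "bound (Suc t) = 2 ^ K * (2 ^ (q * t)) ^ 2"
      unfolding bound_def K_def by (simp add: power_add power_mult[symmetric] algebra_simps)
    then have "real N \<le> 2 ^ K * (2 ^ (q * t)) ^ 2"
      using upper by (metis less_imp_le of_nat_le_iff of_nat_mult of_nat_numeral of_nat_power)
    then have "sqrt (real N) \<le> sqrt (2 ^ K) * 2 ^ (q * t)"
      by (metis real_sqrt_le_mono real_sqrt_mult real_sqrt_abs abs_power2 abs_numeral power_abs)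
    then have "c * sqrt (real N) \<le> 2 ^ (q * t)"
      unfolding c_def by (simp add: field_simps)
    also have "\<dots> \<le> real (Lmax u N)"
      using lower by (metis of_nat_le_iff of_nat_numeral of_nat_power)
    finally show ?thesis .
  qed
  moreover have "c > 0"
    unfolding c_def by simp
  ultimately show ?thesis
    by blast
qed

end
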